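(* If $G$ and $H$ are finitely generated groups which each have a logspace normal form, then the direct product $G\times H$ has a logspace normal form.
   Context: A deterministic logspace transducer is a deterministic machine with a finite state control and three tapes: a read-only input tape storing the input word; a read-write work tape restricted to at most $c\log n$ squares, where $n$ is the length of the input word and $c$ is a fixed constant; and a write-only output tape written from left to right. In each transition it may modify the work tape, change state, move the input read-head, and write at most a fixed constant number of letters to the output tape. For finite alphabets $X,Y$, a function $f:X^*\to Y^*$ is logspace computable if some deterministic logspace transducer outputs $f(w)$ on every input $w\in X^*$ ($X^*$ is the set of finite words over $X$, including the empty word $\lambda$). Let $G$ be a group with finite symmetric (closed under inverses) generating set $X$; for $w\in X^*$ let $\overline{w}\in G$ denote the element it represents. A normal form for $(G,X)$ is a subset $L\subseteq X^*$ such that $w\mapsto\overline{w}$ restricts to a bijection $L\to G$. A logspace normal form function for $(G,X)$ is a logspace computable $f:X^*\to X^*$ such that, for some normal form $L$, $f(w)$ is the unique element of $L$ with $\overline{f(w)}=\overline{w}$, for all $w\in X^*$. $(G,X)$ has a logspace normal form if it has a logspace normal form function; $G$ has a logspace normal form if $(G,X)$ does for some finite symmetric generating set $X$. *)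

theory Defs
  imports Complex_Main "HOL-Algebra.Generated_Groups"
begin

datatype head_move = Move_Left | Stay | Move_Right

(* Contents of an input square; the input word is delimited by two end markers. *)
datatype 'a input_symbol = Left_End | Letter 'a | Right_End

(* 'q: states, 's: work tape symbols, 'a: input letters, 'b: output letters.
   trans q x s depends on the state and the two scanned symbols and yields the new
   state, the work symbol to write, the moves of the input and the work head, and
   the letters appended to the output; None means that the machine halts. *)
record ('q, 's, 'a, 'b) transducer =
  states :: "'q set"
  work_symbols :: "'s set"
  start_state :: 'q
  blank :: 's
  trans :: "'q \<Rightarrow> 'a input_symbol \<Rightarrow> 's
    \<Rightarrow> ('q \<times> 's \<times> head_move \<times> head_move \<times> 'b list) option"

definition input_symbols :: "'a set \<Rightarrow> 'a input_symbol set" where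
  "input_symbols X = insert Left_End (insert Right_End (Letter ` X))"

definition transducer_over ::
    "'a set \<Rightarrow> 'b set \<Rightarrow> ('q, 's, 'a, 'b) transducer \<Rightarrow> bool" where
  "transducer_over X Y M \<longleftrightarrow>
     finite (states M) \<and> start_state M \<in> states M \<and>
     finite (work_symbols M) \<and> blank M \<in> work_symbols M \<and>
     (\<exists>k. \<forall>q\<in>states M. \<forall>x\<in>input_symbols X. \<forall>s\<in>work_symbols M.
        \<forall>q' s' d e v. trans M q x s = Some (q', s', d, e, v) \<longrightarrow>
          q' \<in> states M \<and> s' \<in> work_symbols M \<and> v \<in> lists Y \<and> length v \<le> k)"

(* The work tape is infinite to the right only, with squares numbered from 0. *)
record ('q, 's, 'b) config =
  state :: 'q
  input_pos :: nat
  work_tape :: "nat \<Rightarrow> 's"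
  work_pos :: nat
  written :: "'b list"

(* Square 0 holds the left end marker, squares 1, ..., length w hold the letters of w,
   and square length w + 1 holds the right end marker. *)
definition scanned :: "'a list \<Rightarrow> nat \<Rightarrow> 'a input_symbol" where
  "scanned w i = (if i = 0 then Left_End
                  else if i \<le> length w then Letter (w ! (i - 1))
                  else Right_End)"

(* A move to the left from square 0 has no effect. *)
fun move_head :: "head_move \<Rightarrow> nat \<Rightarrow> nat" where
  "move_head Move_Left i = i - 1"
| "move_head Stay i = i"
| "move_head Move_Right i = i + 1"

definition initial_config :: "('q, 's, 'a, 'b) transducer \<Rightarrow> ('q, 's, 'b) config" where
  "initial_config M =
     \<lparr>state = start_state M, input_pos = 0, work_tape = (\<lambda>_. blank M),
      work_pos = 0, written = []\<rparr>"

(* The min keeps the input head between the end markers; a head free to run away from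
   the input word would act as an unbounded counter. *)
definition next_config :: "('q, 's, 'a, 'b) transducer \<Rightarrow> 'a list
    \<Rightarrow> ('q, 's, 'b) config \<Rightarrow> ('q, 's, 'b) config option" where
  "next_config M w c =
     (case trans M (state c) (scanned w (input_pos c)) (work_tape c (work_pos c)) of
        None \<Rightarrow> None
      | Some (q, s, d, e, v) \<Rightarrow>
          Some \<lparr>state = q,
                input_pos = min (move_head d (input_pos c)) (length w + 1),
                work_tape = (work_tape c)(work_pos c := s),
                work_pos = move_head e (work_pos c),
                written = written c @ v\<rparr>)"

definition reachable :: "('q, 's, 'a, 'b) transducer \<Rightarrow> 'a list
    \<Rightarrow> ('q, 's, 'b) config \<Rightarrow> bool" where
  "reachable M w = (\<lambda>c c'. next_config M w c = Some c')\<^sup>*\<^sup>* (initial_config M)"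

definition outputs_on :: "('q, 's, 'a, 'b) transducer \<Rightarrow> 'a list \<Rightarrow> 'b list \<Rightarrow> bool" where
  "outputs_on M w v \<longleftrightarrow>
     (\<exists>c. reachable M w c \<and> next_config M w c = None \<and> written c = v)"

(* The work head starts on square 0, so when it stands on square p the run has used at
   least the p + 1 squares 0, ..., p. The max only matters for words of length 0 and 1, where log n is undefined
   or zero; these words get c squares. *)
definition log_space_on ::
    "real \<Rightarrow> ('q, 's, 'a, 'b) transducer \<Rightarrow> 'a list \<Rightarrow> bool" where
  "log_space_on c M w \<longleftrightarrow>
     (\<forall>k. reachable M w k \<longrightarrow>
        real (work_pos k + 1) \<le> c * log 2 (real (max 2 (length w))))"

(* Since states and work symbols range over finite sets, naming them by natural numbers
   is no restriction. *)
definition logspace_computable ::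
    "'a set \<Rightarrow> 'b set \<Rightarrow> ('a list \<Rightarrow> 'b list) \<Rightarrow> bool" where
  "logspace_computable X Y f \<longleftrightarrow>
     finite X \<and> finite Y \<and>
     (\<exists>(M :: (nat, nat, 'a, 'b) transducer) c.
        transducer_over X Y M \<and>
        (\<forall>w\<in>lists X. outputs_on M w (f w) \<and> log_space_on c M w))"

definition word_value :: "('a, 'c) monoid_scheme \<Rightarrow> 'a list \<Rightarrow> 'a" where
  "word_value G w = foldr (\<otimes>\<^bsub>G\<^esub>) w \<one>\<^bsub>G\<^esub>"

definition finitely_generated :: "('a, 'c) monoid_scheme \<Rightarrow> bool" where
  "finitely_generated G \<longleftrightarrow>
     (\<exists>S. finite S \<and> S \<subseteq> carrier G \<and> generate G S = carrier G)"

definition symmetric_generating_set :: "('a, 'c) monoid_scheme \<Rightarrow> 'a set \<Rightarrow> bool" where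
  "symmetric_generating_set G X \<longleftrightarrow>
     X \<subseteq> carrier G \<and> (\<forall>x\<in>X. inv\<^bsub>G\<^esub> x \<in> X) \<and> generate G X = carrier G"

definition normal_form :: "('a, 'c) monoid_scheme \<Rightarrow> 'a set \<Rightarrow> 'a list set \<Rightarrow> bool" where
  "normal_form G X L \<longleftrightarrow> L \<subseteq> lists X \<and> bij_betw (word_value G) L (carrier G)"

definition logspace_normal_form_function ::
    "('a, 'c) monoid_scheme \<Rightarrow> 'a set \<Rightarrow> ('a list \<Rightarrow> 'a list) \<Rightarrow> bool" where
  "logspace_normal_form_function G X f \<longleftrightarrow>
     logspace_computable X X f \<and>
     (\<exists>L. normal_form G X L \<and>
        (\<forall>w\<in>lists X. f w \<in> L \<and> word_value G (f w) = word_value G w))"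

definition has_logspace_normal_form_over ::
    "('a, 'c) monoid_scheme \<Rightarrow> 'a set \<Rightarrow> bool" where
  "has_logspace_normal_form_over G X \<longleftrightarrow> (\<exists>f. logspace_normal_form_function G X f)"

definition has_logspace_normal_form :: "('a, 'c) monoid_scheme \<Rightarrow> bool" where
  "has_logspace_normal_form G \<longleftrightarrow>
     (\<exists>X. finite X \<and> symmetric_generating_set G X \<and> has_logspace_normal_form_over G X)"

end

theory Submission
  imports Defs "HOL-Library.Countable"
begin

text \<open>
  Let \<open>f\<close> and \<open>g\<close> be normal form functions for \<open>(G, X)\<close> and \<open>(H, Y)\<close>. The group \<open>G \<times>\<times> H\<close> is
  generated by \<open>Z = X \<times> {\<one>} \<union> {\<one>} \<times> Y\<close>. A word \<open>w\<close> over \<open>Z\<close> projects to a word over \<open>X\<close>, namely its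
  first components with those outside \<open>X\<close> erased, and likewise to a word over \<open>Y\<close>. Only ones are
  erased, so the values of the two projections are the components of the value of \<open>w\<close>.
  The normal form of \<open>w\<close> is the normal form of the first projection followed by that of the second,
  both read as words over \<open>Z\<close>. Such a concatenation has the pair of the two values as its value, so
  the concatenations of normal forms are in bijection with the elements of \<open>G \<times>\<times> H\<close>.

  That this function is logspace computable rests on two closure properties. The first
  (\<open>logspace_computable_erasing\<close>): a machine for \<open>f\<close> can be run on the projection of \<open>w\<close> without
  storing it, by letting the input head run over the erased letters; the projection is no
  longer than \<open>w\<close>, so the space bound survives, and output letters can be replaced on the fly.
  The second (\<open>logspace_computable_append\<close>): two machines with the same input can be
  run one after the other, appending their outputs, if each has its own track of the work
  tape and a mark on square 0 shows where the heads have to return in between.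

  Both are simulations: a run of the new machine passes through configurations that mirror
  those of the old ones. A simulation only sees the path from the initial to the halting
  configuration; since machines are deterministic, no other configuration is reachable, and a
  space bound on that path is a space bound for the machine.
\<close>


section \<open>Runs in bounded space\<close>

text \<open>
  Recording the space bound in each step makes one simulation argument yield
  both the output and the space used.
\<close>

definition step_within ::
    "('q, 's, 'a, 'b) transducer \<Rightarrow> nat \<Rightarrow> 'a list
      \<Rightarrow> ('q, 's, 'b) config \<Rightarrow> ('q, 's, 'b) config \<Rightarrow> bool" where
  "step_within M B w c c' \<longleftrightarrow> next_config M w c = Some c' \<and> work_pos c' < B"

definition outputs_within ::
    "('q, 's, 'a, 'b) transducer \<Rightarrow> nat \<Rightarrow> 'a list \<Rightarrow> 'b list \<Rightarrow> bool" where
  "outputs_within M B w v \<longleftrightarrow> 0 < B \<and>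
     (\<exists>c. (step_within M B w)\<^sup>*\<^sup>* (initial_config M) c \<and> next_config M w c = None \<and> written c = v)"

lemma outputs_withinI:
  assumes out: "outputs_on M w v" and space: "\<And>k. reachable M w k \<Longrightarrow> work_pos k < B"
  shows "outputs_within M B w v"
proof -
  have within: "(step_within M B w)\<^sup>*\<^sup>* (initial_config M) c" if "reachable M w c" for c
    using that unfolding reachable_def
  proof (induction rule: rtranclp_induct)
    case (step y z)
    then have "work_pos z < B"
      using space[of z] unfolding reachable_def by (simp add: rtranclp.rtrancl_into_rtrancl)
    with step show ?case
      by (simp add: rtranclp.rtrancl_into_rtrancl step_within_def)
  qed simp
  have "work_pos (initial_config M) < B"
    by (rule space) (simp add: reachable_def)
  with out within show ?thesis
    unfolding outputs_within_def outputs_on_def by auto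
qed

lemma outputs_within_imp_outputs_on:
  assumes "outputs_within M B w v"
  shows "outputs_on M w v"
proof -
  have "step_within M B w \<le> (\<lambda>c c'. next_config M w c = Some c')"
    by (auto simp: step_within_def)
  then show ?thesis
    using assms rtranclp_mono unfolding outputs_within_def outputs_on_def reachable_def by blast
qed

text \<open>
  By determinism, every reachable configuration lies on the run that witnesses the output.
\<close>

lemma outputs_within_imp_space:
  assumes out: "outputs_within M B w v" and k: "reachable M w k"
  shows "work_pos k < B"
proof -
  obtain c where c: "(step_within M B w)\<^sup>*\<^sup>* (initial_config M) c" "next_config M w c = None"
    using out by (auto simp: outputs_within_def)
  have "work_pos k < B"
    if "(step_within M B w)\<^sup>*\<^sup>* a c" "work_pos a < B"
      "(\<lambda>c c'. next_config M w c = Some c')\<^sup>*\<^sup>* a k" for a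
    using that
  proof (induction rule: converse_rtranclp_induct)
    case base
    from base(2) c(2) have "k = c"
      by (auto elim: converse_rtranclpE)
    with base show ?case by simp
  next
    case (step a a')
    from step.prems(2) show ?case
    proof (cases rule: converse_rtranclpE)
      case base
      with step.prems show ?thesis by simp
    next
      case (step a'')
      with step.hyps show ?thesis
        using step.IH by (auto simp: step_within_def)
    qed
  qed
  moreover have "work_pos (initial_config M) < B"
    using out by (simp add: outputs_within_def initial_config_def)
  ultimately show ?thesis
    using c(1) k unfolding reachable_def by blast
qed

text \<open>
  The relation \<open>R\<close> need only hold again after finitely many steps of the simulating machine,
  which may pass through configurations that correspond to nothing.
\<close>

lemma simulation:
  assumes "(step_within M B w)\<^sup>*\<^sup>* c c'" and "R c d"
    and "\<And>c c' d. step_within M B w c c' \<Longrightarrow> R c d \<Longrightarrow>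
           \<exists>d'. (step_within M' B' w')\<^sup>*\<^sup>* d d' \<and> R c' d'"
  shows "\<exists>d'. (step_within M' B' w')\<^sup>*\<^sup>* d d' \<and> R c' d'"
  using assms(1,2)
proof (induction rule: rtranclp_induct)
  case (step y z)
  then show ?case using assms(3) by (meson rtranclp_trans)
qed blast


section \<open>Machines with arbitrary countable sets of states and symbols\<close>

text \<open>
  The machines below have structured states and work symbols; numbering them turns
  each machine into one over \<^typ>\<open>nat\<close> with the same runs.
\<close>

definition name_by_nat ::
    "('q::countable, 's::countable, 'a, 'b) transducer \<Rightarrow> (nat, nat, 'a, 'b) transducer" where
  "name_by_nat M =
     \<lparr>states = to_nat ` states M, work_symbols = to_nat ` work_symbols M,
      start_state = to_nat (start_state M), blank = to_nat (blank M),
      trans = (\<lambda>q x s. map_option (\<lambda>(q', s', d, e, v). (to_nat q', to_nat s', d, e, v))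
        (trans M (from_nat q) x (from_nat s)))\<rparr>"

definition config_by_nat ::
    "('q::countable, 's::countable, 'b) config \<Rightarrow> (nat, nat, 'b) config" where
  "config_by_nat c =
     \<lparr>state = to_nat (state c), input_pos = input_pos c, work_tape = to_nat \<circ> work_tape c,
      work_pos = work_pos c, written = written c\<rparr>"

lemma next_config_name_by_nat:
  "next_config (name_by_nat M) w (config_by_nat c) = map_option config_by_nat (next_config M w c)"
  by (auto simp: next_config_def name_by_nat_def config_by_nat_def fun_eq_iff split: option.split)

lemma outputs_within_name_by_nat:
  assumes "outputs_within M B w v"
  shows "outputs_within (name_by_nat M) B w v"
proof -
  obtain c where c: "(step_within M B w)\<^sup>*\<^sup>* (initial_config M) c"
      "next_config M w c = None" "written c = v" and B: "0 < B"
    using assms by (auto simp: outputs_within_def)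
  have init: "initial_config (name_by_nat M) = config_by_nat (initial_config M)"
    by (simp add: initial_config_def name_by_nat_def config_by_nat_def comp_def)
  have "\<exists>d. (step_within (name_by_nat M) B w)\<^sup>*\<^sup>* (initial_config (name_by_nat M)) d
      \<and> d = config_by_nat c"
  proof (rule simulation[OF c(1)])
    fix c c' d assume "step_within M B w c c'" "d = config_by_nat c"
    then have "step_within (name_by_nat M) B w d (config_by_nat c')"
      by (simp add: step_within_def next_config_name_by_nat) (simp add: config_by_nat_def)
    then show "\<exists>d'. (step_within (name_by_nat M) B w)\<^sup>*\<^sup>* d d' \<and> d' = config_by_nat c'"
      by blast
  qed (rule init)
  then have run: "(step_within (name_by_nat M) B w)\<^sup>*\<^sup>* (initial_config (name_by_nat M)) (config_by_nat c)"
    by simp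
  have "next_config (name_by_nat M) w (config_by_nat c) = None" "written (config_by_nat c) = v"
    using c(2,3) by (simp_all add: next_config_name_by_nat) (simp add: config_by_nat_def)
  with run B show ?thesis
    unfolding outputs_within_def by blast
qed

lemma transducer_over_name_by_nat:
  assumes "transducer_over X Y M"
  shows "transducer_over X Y (name_by_nat M)"
proof -
  obtain k where k: "\<forall>q\<in>states M. \<forall>x\<in>input_symbols X. \<forall>s\<in>work_symbols M.
        \<forall>q' s' d e v. trans M q x s = Some (q', s', d, e, v) \<longrightarrow>
          q' \<in> states M \<and> s' \<in> work_symbols M \<and> v \<in> lists Y \<and> length v \<le> k"
    using assms unfolding transducer_over_def by blast
  have "\<forall>q\<in>states (name_by_nat M). \<forall>x\<in>input_symbols X. \<forall>s\<in>work_symbols (name_by_nat M).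
        \<forall>q' s' d e v. trans (name_by_nat M) q x s = Some (q', s', d, e, v) \<longrightarrow>
          q' \<in> states (name_by_nat M) \<and> s' \<in> work_symbols (name_by_nat M) \<and>
          v \<in> lists Y \<and> length v \<le> k"
    using k by (fastforce simp: name_by_nat_def)
  moreover have "finite (states (name_by_nat M)) \<and> start_state (name_by_nat M) \<in> states (name_by_nat M) \<and>
     finite (work_symbols (name_by_nat M)) \<and> blank (name_by_nat M) \<in> work_symbols (name_by_nat M)"
    using assms by (simp add: transducer_over_def name_by_nat_def)
  ultimately show ?thesis
    unfolding transducer_over_def by blast
qed

lemma logspace_computableI:
  fixes M :: "('q::countable, 's::countable, 'a, 'b) transducer"
  assumes "finite X" "finite Y" and over: "transducer_over X Y M"
    and out: "\<And>w. w \<in> lists X \<Longrightarrow> \<exists>B. outputs_within M B w (f w) \<and>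
                real B \<le> c * log 2 (real (max 2 (length w)))"
  shows "logspace_computable X Y f"
  unfolding logspace_computable_def
proof (intro conjI exI ballI)
  show "transducer_over X Y (name_by_nat M)"
    by (rule transducer_over_name_by_nat[OF over])
  fix w assume "w \<in> lists X"
  then obtain B where B: "outputs_within (name_by_nat M) B w (f w)"
      "real B \<le> c * log 2 (real (max 2 (length w)))"
    using out outputs_within_name_by_nat by blast
  show "outputs_on (name_by_nat M) w (f w)"
    by (rule outputs_within_imp_outputs_on[OF B(1)])
  show "log_space_on c (name_by_nat M) w"
    unfolding log_space_on_def
  proof (intro allI impI)
    fix k assume "reachable (name_by_nat M) w k"
    then have "work_pos k < B" by (rule outputs_within_imp_space[OF B(1)])
    then have "real (work_pos k + 1) \<le> real B"
      by linarith
    with B(2) show "real (work_pos k + 1) \<le> c * log 2 (real (max 2 (length w)))"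
      by linarith
  qed
qed (use assms in auto)

text \<open>
  The bound \<open>B\<close> is the integer part of the permitted space. The empty word forces \<open>c\<close> to be
  nonnegative, because the initial configuration already uses a square; hence the permitted
  space does not decrease when the word gets longer.
\<close>

lemma logspace_computableE:
  assumes "logspace_computable X Y f"
  obtains M :: "(nat, nat, 'a, 'b) transducer" and c
  where "finite X" "finite Y" "transducer_over X Y M" "0 \<le> c"
    "\<And>w. w \<in> lists X \<Longrightarrow> \<exists>B. outputs_within M B w (f w) \<and>
        real B \<le> c * log 2 (real (max 2 (length w)))"
proof -
  obtain M :: "(nat, nat, 'a, 'b) transducer" and c where M: "transducer_over X Y M"
      "\<forall>w\<in>lists X. outputs_on M w (f w) \<and> log_space_on c M w"
    using assms unfolding logspace_computable_def by blast
  have start: "1 \<le> c * log 2 (real (max 2 (length w)))" if "w \<in> lists X" for w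
  proof -
    have "reachable M w (initial_config M)" by (simp add: reachable_def)
    then have "real (work_pos (initial_config M) + 1) \<le> c * log 2 (real (max 2 (length w)))"
      using M(2) that unfolding log_space_on_def by blast
    then show ?thesis by (simp add: initial_config_def)
  qed
  have "0 \<le> c" using start[of "[]"] by simp
  moreover have "\<exists>B. outputs_within M B w (f w) \<and> real B \<le> c * log 2 (real (max 2 (length w)))"
    if w: "w \<in> lists X" for w
  proof (intro exI conjI)
    let ?r = "c * log 2 (real (max 2 (length w)))"
    show "outputs_within M (nat \<lfloor>?r\<rfloor>) w (f w)"
    proof (rule outputs_withinI)
      fix k assume "reachable M w k"
      then have "real (work_pos k + 1) \<le> ?r"
        using M(2) w unfolding log_space_on_def by blast
      then have "int (work_pos k + 1) \<le> \<lfloor>?r\<rfloor>" by (simp add: le_floor_iff)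
      then show "work_pos k < nat \<lfloor>?r\<rfloor>" by linarith
    qed (use M w in blast)
    show "real (nat \<lfloor>?r\<rfloor>) \<le> ?r"
      using start[OF w] by (simp add: of_nat_nat)
  qed
  ultimately show ?thesis
    using that M(1) assms unfolding logspace_computable_def by blast
qed


section \<open>Erasing input letters\<close>

text \<open>
  A partial map \<open>\<phi>\<close> on letters acts on words by \<^term>\<open>List.map_filter \<phi>\<close>: it erases the letters
  on which it is undefined and replaces the others. The end markers are always kept.
\<close>

fun erase_symbol :: "('z \<Rightarrow> 'a option) \<Rightarrow> 'z input_symbol \<Rightarrow> 'a input_symbol option" where
  "erase_symbol \<phi> Left_End = Some Left_End"
| "erase_symbol \<phi> Right_End = Some Right_End"
| "erase_symbol \<phi> (Letter z) = map_option Letter (\<phi> z)"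

definition kept :: "('z \<Rightarrow> 'a option) \<Rightarrow> 'z list \<Rightarrow> nat \<Rightarrow> bool" where
  "kept \<phi> w p \<longleftrightarrow> erase_symbol \<phi> (scanned w p) \<noteq> None"

text \<open>
  The position in the erased word that corresponds to a kept square \<open>p\<close> of the original word.
  Counting kept squares treats the right end marker like a letter, so that the head
  positions of the simulated machine need no case distinction.
\<close>

fun rank :: "('z \<Rightarrow> 'a option) \<Rightarrow> 'z list \<Rightarrow> nat \<Rightarrow> nat" where
  "rank \<phi> w 0 = 0"
| "rank \<phi> w (Suc p) = (if kept \<phi> w (Suc p) then Suc (rank \<phi> w p) else rank \<phi> w p)"

lemma rank_eq_length:
  "p \<le> length w \<Longrightarrow> rank \<phi> w p = length (List.map_filter \<phi> (take p w))"
  by (induction p)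
    (auto simp: kept_def scanned_def take_Suc_conv_app_nth map_filter_def)

lemma rank_Right_End: "rank \<phi> w (Suc (length w)) = Suc (length (List.map_filter \<phi> w))"
  by (simp add: rank_eq_length kept_def scanned_def)

lemma rank_le_length: "p \<le> length w \<Longrightarrow> rank \<phi> w p \<le> length (List.map_filter \<phi> w)"
  using rank_eq_length[of p w \<phi>]
  by (subst append_take_drop_id[of p w, symmetric])
    (simp add: map_filter_def del: append_take_drop_id)

text \<open>
  On a kept square, the simulating machine can tell from the scanned symbol what the simulated
  machine scans at the corresponding position.
\<close>

lemma scanned_erased:
  assumes "kept \<phi> w p" "p \<le> Suc (length w)"
  shows "erase_symbol \<phi> (scanned w p) = Some (scanned (List.map_filter \<phi> w) (rank \<phi> w p))"
proof -
  consider "p = 0" | "p = Suc (length w)" | i where "p = Suc i" "i < length w"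
    using assms(2) by (cases p) (auto simp: le_less)
  then show ?thesis
  proof cases
    case 2
    then show ?thesis
      by (simp only: rank_Right_End) (simp add: scanned_def)
  next
    case 3
    then obtain a where a: "\<phi> (w ! i) = Some a"
      using assms(1) by (auto simp: kept_def scanned_def)
    let ?l = "List.map_filter \<phi> (take i w)" and ?r = "List.map_filter \<phi> (drop (Suc i) w)"
    have "w = take i w @ w ! i # drop (Suc i) w"
      using 3 by (simp add: id_take_nth_drop)
    then have "List.map_filter \<phi> w = List.map_filter \<phi> (take i w @ w ! i # drop (Suc i) w)"
      by simp
    also have "\<dots> = ?l @ a # ?r"
      using a by (simp add: map_filter_def)
    finally have u: "List.map_filter \<phi> w = ?l @ a # ?r" .
    have r: "rank \<phi> w p = Suc (length ?l)"
      using assms(1) 3 by (simp add: rank_eq_length)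
    show ?thesis
      unfolding u r using 3 a by (simp add: scanned_def)
  qed (simp add: scanned_def)
qed

text \<open>
  One move of the simulated head is a run over erased letters followed by one kept square.
  Such a square exists in either direction because the end markers are kept.
\<close>

lemma next_kept_right:
  assumes "p \<le> length w"
  shows "\<exists>n. kept \<phi> w (Suc (p + n)) \<and> p + n \<le> length w \<and> (\<forall>j<n. \<not> kept \<phi> w (Suc (p + j)))
    \<and> rank \<phi> w (Suc (p + n)) = Suc (rank \<phi> w p)"
proof -
  let ?P = "\<lambda>n. kept \<phi> w (Suc (p + n))"
  have ex: "kept \<phi> w (Suc (p + (length w - p)))"
    using assms by (simp add: kept_def scanned_def)
  define n where "n = (LEAST n. kept \<phi> w (Suc (p + n)))"
  have n: "kept \<phi> w (Suc (p + n))" "n \<le> length w - p" "\<forall>j<n. \<not> kept \<phi> w (Suc (p + j))"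
    using LeastI[of ?P, OF ex] Least_le[of ?P, OF ex] not_less_Least[of _ ?P]
    unfolding n_def by blast+
  have "rank \<phi> w (p + j) = rank \<phi> w p" if "j \<le> n" for j
    using that n(3) by (induction j) auto
  then show ?thesis
    using n assms by (intro exI[of _ n]) auto
qed

lemma next_kept_left:
  assumes "kept \<phi> w (Suc p)"
  shows "\<exists>n\<le>p. kept \<phi> w (p - n) \<and> (\<forall>j<n. \<not> kept \<phi> w (p - j))
    \<and> rank \<phi> w (p - n) = rank \<phi> w (Suc p) - 1"
proof -
  let ?P = "\<lambda>n. kept \<phi> w (p - n)"
  have ex: "kept \<phi> w (p - p)"
    by (simp add: kept_def scanned_def)
  define n where "n = (LEAST n. kept \<phi> w (p - n))"
  have n: "kept \<phi> w (p - n)" "n \<le> p" "\<forall>j<n. \<not> kept \<phi> w (p - j)"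
    using LeastI[of ?P, OF ex] Least_le[of ?P, OF ex] not_less_Least[of _ ?P]
    unfolding n_def by blast+
  have "rank \<phi> w (p - j) = rank \<phi> w p" if "j \<le> n" for j
    using that
  proof (induction j)
    case (Suc j)
    then have "p - j = Suc (p - Suc j)" "\<not> kept \<phi> w (p - j)"
      using n by auto
    with Suc show ?case by simp
  qed simp
  then show ?thesis
    using n assms by (intro exI[of _ n]) auto
qed

instance head_move :: countable
  by countable_datatype

text \<open>
  The second component of a state is the direction of the last move of the simulated head, in which
  the input head continues as long as it scans erased letters; \<^const>\<open>Stay\<close> means that it has
  arrived and the next step of \<open>M\<close> can be simulated.
\<close>

definition erasing_transducer ::
    "('z \<Rightarrow> 'a option) \<Rightarrow> ('b \<Rightarrow> 'y) \<Rightarrow> ('q, 's, 'a, 'b) transducer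
      \<Rightarrow> ('q \<times> head_move, 's, 'z, 'y) transducer" where
  "erasing_transducer \<phi> \<psi> M =
     \<lparr>states = states M \<times> {Move_Left, Stay, Move_Right}, work_symbols = work_symbols M,
      start_state = (start_state M, Stay), blank = blank M,
      trans = (\<lambda>(q, m) z s.
        case erase_symbol \<phi> z of
          None \<Rightarrow> Some ((q, m), s, m, Stay, [])
        | Some x \<Rightarrow>
            if m = Stay
            then map_option (\<lambda>(q', s', d, e, v). ((q', d), s', d, e, map \<psi> v)) (trans M q x s)
            else Some ((q, Stay), s, Stay, Stay, []))\<rparr>"

lemma transducer_over_erasing:
  assumes M: "transducer_over X Y M"
    and \<phi>: "\<And>z a. z \<in> Z \<Longrightarrow> \<phi> z = Some a \<Longrightarrow> a \<in> X" and \<psi>: "\<And>y. y \<in> Y \<Longrightarrow> \<psi> y \<in> W"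
  shows "transducer_over Z W (erasing_transducer \<phi> \<psi> M)"
proof -
  let ?N = "erasing_transducer \<phi> \<psi> M"
  obtain k where k: "\<And>q x s q' s' d e v. q \<in> states M \<Longrightarrow> x \<in> input_symbols X \<Longrightarrow>
        s \<in> work_symbols M \<Longrightarrow> trans M q x s = Some (q', s', d, e, v) \<Longrightarrow>
          q' \<in> states M \<and> s' \<in> work_symbols M \<and> v \<in> lists Y \<and> length v \<le> k"
    using M unfolding transducer_over_def by blast
  have moves: "d \<in> {Move_Left, Stay, Move_Right}" for d
    by (cases d) auto
  have "q' \<in> states ?N \<and> s' \<in> work_symbols ?N \<and> v \<in> lists W \<and> length v \<le> k"
    if asm: "q \<in> states ?N" "z \<in> input_symbols Z" "s \<in> work_symbols ?N"
      and step: "trans ?N q z s = Some (q', s', d, e, v)" for q z s q' s' d e v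
  proof (cases "erase_symbol \<phi> z")
    case None
    with asm step show ?thesis
      by (auto simp: erasing_transducer_def)
  next
    case (Some x)
    with asm(2) \<phi> have x: "x \<in> input_symbols X"
      by (auto simp: input_symbols_def)
    obtain q0 m where q: "q = (q0, m)" by (cases q)
    show ?thesis
    proof (cases "m = Stay")
      case True
      with Some step q obtain q1 v0 where
        t: "trans M q0 x s = Some (q1, s', d, e, v0)" "q' = (q1, d)" "v = map \<psi> v0"
        by (auto simp: erasing_transducer_def)
      have "q1 \<in> states M \<and> s' \<in> work_symbols M \<and> v0 \<in> lists Y \<and> length v0 \<le> k"
        by (rule k[OF _ x _ t(1)]) (use asm q in \<open>auto simp: erasing_transducer_def\<close>)
      with t \<psi> moves show ?thesis
        by (auto simp: erasing_transducer_def)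
    next
      case False
      with Some asm step q show ?thesis
        by (auto simp: erasing_transducer_def)
    qed
  qed
  moreover have "finite (states ?N)" "start_state ?N \<in> states ?N"
      "finite (work_symbols ?N)" "blank ?N \<in> work_symbols ?N"
    using M by (auto simp: erasing_transducer_def transducer_over_def)
  ultimately show ?thesis
    unfolding transducer_over_def by blast
qed

lemma skip_right:
  assumes "kept \<phi> w (p + n)" "p + n \<le> Suc (length w)" "\<forall>j<n. \<not> kept \<phi> w (p + j)" "i < B"
  shows "(step_within (erasing_transducer \<phi> \<psi> M) B w)\<^sup>*\<^sup>*
    \<lparr>state = (q, Move_Right), input_pos = p, work_tape = t, work_pos = i, written = v\<rparr>
    \<lparr>state = (q, Stay), input_pos = p + n, work_tape = t, work_pos = i, written = v\<rparr>"
  using assms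
proof (induction n arbitrary: p)
  case 0
  then show ?case
    by (intro r_into_rtranclp)
      (auto simp: step_within_def next_config_def erasing_transducer_def kept_def)
next
  case (Suc n)
  then have "\<not> kept \<phi> w p" by force
  with Suc.prems have "step_within (erasing_transducer \<phi> \<psi> M) B w
    \<lparr>state = (q, Move_Right), input_pos = p, work_tape = t, work_pos = i, written = v\<rparr>
    \<lparr>state = (q, Move_Right), input_pos = Suc p, work_tape = t, work_pos = i, written = v\<rparr>"
    by (auto simp: step_within_def next_config_def erasing_transducer_def kept_def)
  moreover have "\<forall>j<n. \<not> kept \<phi> w (Suc p + j)"
    using Suc.prems(3) by force
  ultimately show ?case
    using Suc.IH[of "Suc p"] Suc.prems by (simp add: converse_rtranclp_into_rtranclp)
qed

lemma skip_left:
  assumes "kept \<phi> w (p - n)" "p \<le> Suc (length w)" "\<forall>j<n. \<not> kept \<phi> w (p - j)" "i < B"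
  shows "(step_within (erasing_transducer \<phi> \<psi> M) B w)\<^sup>*\<^sup>*
    \<lparr>state = (q, Move_Left), input_pos = p, work_tape = t, work_pos = i, written = v\<rparr>
    \<lparr>state = (q, Stay), input_pos = p - n, work_tape = t, work_pos = i, written = v\<rparr>"
  using assms
proof (induction n arbitrary: p)
  case 0
  then show ?case
    by (intro r_into_rtranclp)
      (auto simp: step_within_def next_config_def erasing_transducer_def kept_def)
next
  case (Suc n)
  then have "\<not> kept \<phi> w p" by force
  with Suc.prems have "step_within (erasing_transducer \<phi> \<psi> M) B w
    \<lparr>state = (q, Move_Left), input_pos = p, work_tape = t, work_pos = i, written = v\<rparr>
    \<lparr>state = (q, Move_Left), input_pos = p - 1, work_tape = t, work_pos = i, written = v\<rparr>"
    by (auto simp: step_within_def next_config_def erasing_transducer_def kept_def)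
  moreover have "\<forall>j<n. \<not> kept \<phi> w (p - 1 - j)"
    using Suc.prems(3) by force
  ultimately show ?case
    using Suc.IH[of "p - 1"] Suc.prems by (simp add: converse_rtranclp_into_rtranclp)
qed

text \<open>
  The configurations between two simulated steps: the input head is on the kept square whose
  rank is the position of the simulated head.
\<close>

definition erasing_sim ::
    "('z \<Rightarrow> 'a option) \<Rightarrow> ('b \<Rightarrow> 'y) \<Rightarrow> 'z list
      \<Rightarrow> ('q, 's, 'b) config \<Rightarrow> ('q \<times> head_move, 's, 'y) config \<Rightarrow> bool" where
  "erasing_sim \<phi> \<psi> w c d \<longleftrightarrow>
     (\<exists>p. kept \<phi> w p \<and> p \<le> Suc (length w) \<and> input_pos c = rank \<phi> w p \<and>
       d = \<lparr>state = (state c, Stay), input_pos = p, work_tape = work_tape c,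
            work_pos = work_pos c, written = map \<psi> (written c)\<rparr>)"

lemma erasing_sim_step:
  assumes step: "step_within M B (List.map_filter \<phi> w) c c'" and sim: "erasing_sim \<phi> \<psi> w c d"
  shows "\<exists>d'. (step_within (erasing_transducer \<phi> \<psi> M) B w)\<^sup>*\<^sup>* d d' \<and> erasing_sim \<phi> \<psi> w c' d'"
proof -
  let ?N = "erasing_transducer \<phi> \<psi> M" and ?u = "List.map_filter \<phi> w"
  obtain p where p: "kept \<phi> w p" "p \<le> Suc (length w)" "input_pos c = rank \<phi> w p"
      and d: "d = \<lparr>state = (state c, Stay), input_pos = p, work_tape = work_tape c,
            work_pos = work_pos c, written = map \<psi> (written c)\<rparr>"
    using sim by (auto simp: erasing_sim_def)
  note scan = scanned_erased[OF p(1,2)]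
  obtain q s m e v where t: "trans M (state c) (scanned ?u (rank \<phi> w p)) (work_tape c (work_pos c))
        = Some (q, s, m, e, v)"
      and c': "c' = \<lparr>state = q, input_pos = min (move_head m (rank \<phi> w p)) (length ?u + 1),
                work_tape = (work_tape c)(work_pos c := s),
                work_pos = move_head e (work_pos c), written = written c @ v\<rparr>"
    using step p(3) by (auto simp: step_within_def next_config_def split: option.splits)
  let ?after = "\<lambda>m p. \<lparr>state = (q, m), input_pos = p,
                work_tape = (work_tape c)(work_pos c := s),
                work_pos = move_head e (work_pos c), written = map \<psi> (written c @ v)\<rparr>"
  have i: "move_head e (work_pos c) < B"
    using step c' by (simp add: step_within_def)
  \<comment> \<open>The simulated step itself; after it the head may stand on an erased letter.\<close>
  have first: "step_within ?N B w d (?after m (min (move_head m p) (length w + 1)))"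
    using t scan i by (simp add: step_within_def next_config_def d erasing_transducer_def)
  have le: "rank \<phi> w p \<le> Suc (length ?u)"
    using p(2) rank_Right_End[of \<phi> w] rank_le_length[of p w \<phi>] by (auto simp: le_Suc_eq simp del: rank.simps)
  \<comment> \<open>The head then runs on to the next kept square, whose rank is the new simulated position.\<close>
  have "\<exists>p'. (step_within ?N B w)\<^sup>*\<^sup>* (?after m (min (move_head m p) (length w + 1))) (?after Stay p') \<and>
      kept \<phi> w p' \<and> p' \<le> Suc (length w) \<and>
      min (move_head m (rank \<phi> w p)) (length ?u + 1) = rank \<phi> w p'"
  proof (cases m)
    case Stay
    with p le show ?thesis
      by (intro exI[of _ p]) simp
  next
    case Move_Right
    show ?thesis
    proof (cases "p = Suc (length w)")
      case True
      then have "rank \<phi> w p = Suc (length ?u)" by (simp only: rank_Right_End)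
      then show ?thesis
        using skip_right[of \<phi> w p 0, OF _ _ _ i] p(1) Move_Right True
        by (intro exI[of _ p]) simp
    next
      case False
      with p(2) have "p \<le> length w" by simp
      then obtain n where n: "kept \<phi> w (Suc (p + n))" "p + n \<le> length w"
          "\<forall>j<n. \<not> kept \<phi> w (Suc (p + j))" "rank \<phi> w (Suc (p + n)) = Suc (rank \<phi> w p)"
        using next_kept_right by blast
      have "rank \<phi> w p \<le> length ?u"
        using \<open>p \<le> length w\<close> by (rule rank_le_length)
      with n \<open>p \<le> length w\<close> show ?thesis
        using skip_right[of \<phi> w "Suc p" n, OF _ _ _ i] Move_Right
        by (intro exI[of _ "Suc (p + n)"]) (simp del: rank.simps)
    qed
  next
    case Move_Left
    show ?thesis
    proof (cases p)
      case 0
      then show ?thesis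
        using skip_left[of \<phi> w p 0, OF _ _ _ i] p(1) Move_Left
        by (intro exI[of _ p]) simp
    next
      case (Suc p0)
      then obtain n where n: "n \<le> p0" "kept \<phi> w (p0 - n)"
          "\<forall>j<n. \<not> kept \<phi> w (p0 - j)" "rank \<phi> w (p0 - n) = rank \<phi> w p - 1"
        using next_kept_left p(1) by blast
      have "(step_within ?N B w)\<^sup>*\<^sup>* (?after Move_Left p0) (?after Stay (p0 - n))"
        by (rule skip_left[OF n(2) _ n(3) i]) (use Suc p(2) in simp)
      moreover have "min (move_head m p) (length w + 1) = p0"
          "min (move_head m (rank \<phi> w p)) (length ?u + 1) = rank \<phi> w (p0 - n)"
          "p0 - n \<le> Suc (length w)"
        using Move_Left Suc p(2) le n(4) by (auto simp del: rank.simps)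
      ultimately show ?thesis
        using n(2) Move_Left by auto
    qed
  qed
  then obtain p' where p': "(step_within ?N B w)\<^sup>*\<^sup>*
        (?after m (min (move_head m p) (length w + 1))) (?after Stay p')"
      "kept \<phi> w p'" "p' \<le> Suc (length w)"
      "min (move_head m (rank \<phi> w p)) (length ?u + 1) = rank \<phi> w p'"
    by blast
  have "erasing_sim \<phi> \<psi> w c' (?after Stay p')"
    unfolding erasing_sim_def using p' by (intro exI[of _ p']) (simp add: c')
  then show ?thesis
    using first p'(1) by (meson converse_rtranclp_into_rtranclp)
qed

lemma outputs_within_erasing:
  assumes "outputs_within M B (List.map_filter \<phi> w) v"
  shows "outputs_within (erasing_transducer \<phi> \<psi> M) B w (map \<psi> v)"
proof -
  let ?N = "erasing_transducer \<phi> \<psi> M"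
  obtain c where c: "(step_within M B (List.map_filter \<phi> w))\<^sup>*\<^sup>* (initial_config M) c"
      "next_config M (List.map_filter \<phi> w) c = None" "written c = v" and B: "0 < B"
    using assms by (auto simp: outputs_within_def)
  have "erasing_sim \<phi> \<psi> w (initial_config M) (initial_config ?N)"
    unfolding erasing_sim_def
    by (intro exI[of _ 0]) (simp add: kept_def scanned_def initial_config_def erasing_transducer_def)
  then have "\<exists>d. (step_within ?N B w)\<^sup>*\<^sup>* (initial_config ?N) d \<and> erasing_sim \<phi> \<psi> w c d"
    by (rule simulation[OF c(1)]) (rule erasing_sim_step)
  then obtain d where d: "(step_within ?N B w)\<^sup>*\<^sup>* (initial_config ?N) d" "erasing_sim \<phi> \<psi> w c d"
    by blast
  from d(2) obtain p where p: "kept \<phi> w p" "p \<le> Suc (length w)" "input_pos c = rank \<phi> w p"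
      "d = \<lparr>state = (state c, Stay), input_pos = p, work_tape = work_tape c,
            work_pos = work_pos c, written = map \<psi> (written c)\<rparr>"
    by (auto simp: erasing_sim_def)
  have "next_config ?N w d = None"
    using c(2) p scanned_erased[OF p(1,2)]
    by (auto simp: next_config_def erasing_transducer_def split: option.splits)
  with d(1) p(4) c(3) B show ?thesis
    unfolding outputs_within_def by auto
qed

lemma logspace_computable_erasing:
  fixes f :: "'a list \<Rightarrow> 'b list"
  assumes f: "logspace_computable X Y f" and fin: "finite Z" "finite W"
    and \<phi>: "\<And>z a. z \<in> Z \<Longrightarrow> \<phi> z = Some a \<Longrightarrow> a \<in> X" and \<psi>: "\<And>y. y \<in> Y \<Longrightarrow> \<psi> y \<in> W"
  shows "logspace_computable Z W (\<lambda>w. map \<psi> (f (List.map_filter \<phi> w)))"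
proof -
  obtain M :: "(nat, nat, 'a, 'b) transducer" and c where M: "finite X" "finite Y" "transducer_over X Y M" "0 \<le> c"
    "\<And>w. w \<in> lists X \<Longrightarrow> \<exists>B. outputs_within M B w (f w) \<and>
        real B \<le> c * log 2 (real (max 2 (length w)))"
    by (rule logspace_computableE[OF f]) (rule that; assumption)
  show ?thesis
  proof (rule logspace_computableI[OF fin transducer_over_erasing[of X Y M]])
    fix w assume w: "w \<in> lists Z"
    let ?u = "List.map_filter \<phi> w"
    have "?u \<in> lists X"
      using w \<phi> by (force simp: map_filter_def)
    then obtain B where B: "outputs_within M B ?u (f ?u)"
        "real B \<le> c * log 2 (real (max 2 (length ?u)))"
      using M(5) by blast
    \<comment> \<open>Logarithmic in the erased word is also logarithmic in the longer original.\<close>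
    have "length ?u \<le> length w" by (simp add: map_filter_def)
    then have "log 2 (real (max 2 (length ?u))) \<le> log 2 (real (max 2 (length w)))"
      by (subst log_le_cancel_iff) auto
    then have "real B \<le> c * log 2 (real (max 2 (length w)))"
      using B(2) M(4) by (meson mult_left_mono order_trans)
    then show "\<exists>B. outputs_within (erasing_transducer \<phi> \<psi> M) B w (map \<psi> (f ?u)) \<and>
        real B \<le> c * log 2 (real (max 2 (length w)))"
      using outputs_within_erasing[OF B(1)] by blast
  qed (use M \<phi> \<psi> in auto)
qed


section \<open>Running one machine after another\<close>

datatype phase = Start | First nat | Rewind | Second nat

instance phase :: countable
  by countable_datatype

text \<open>
  A work symbol consists of a mark and one symbol for each of the two machines, so that \<open>N\<close>
  finds its own track blank. Step one marks square 0. After \<open>M\<close> halts, both heads are moved to the left until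
  the left end marker and the mark are scanned together; a head that arrives early stays
  at its end, as a move to the left from square 0 has no effect.
\<close>

definition sequential_transducer ::
    "(nat, nat, 'a, 'b) transducer \<Rightarrow> (nat, nat, 'a, 'b) transducer
      \<Rightarrow> (phase, bool \<times> nat \<times> nat, 'a, 'b) transducer" where
  "sequential_transducer M N =
     \<lparr>states = {Start, Rewind} \<union> First ` states M \<union> Second ` states N,
      work_symbols = UNIV \<times> work_symbols M \<times> work_symbols N,
      start_state = Start, blank = (False, blank M, blank N),
      trans = (\<lambda>q x (leftmost, s, r).
        case q of
          Start \<Rightarrow> Some (First (start_state M), (True, s, r), Stay, Stay, [])
        | First p \<Rightarrow>
            (case trans M p x s of
               None \<Rightarrow> Some (Rewind, (leftmost, s, r), Stay, Stay, [])
             | Some (p', s', d, e, v) \<Rightarrow> Some (First p', (leftmost, s', r), d, e, v))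
        | Rewind \<Rightarrow>
            if leftmost \<and> x = Left_End
            then Some (Second (start_state N), (leftmost, s, r), Stay, Stay, [])
            else Some (Rewind, (leftmost, s, r), Move_Left, Move_Left, [])
        | Second p \<Rightarrow>
            map_option (\<lambda>(p', r', d, e, v). (Second p', (leftmost, s, r'), d, e, v))
              (trans N p x r))\<rparr>"

lemma transducer_over_sequential:
  assumes M: "transducer_over X Y M" and N: "transducer_over X Y N"
  shows "transducer_over X Y (sequential_transducer M N)"
proof -
  let ?S = "sequential_transducer M N"
  obtain k where k: "\<And>q x s q' s' d e v. q \<in> states M \<Longrightarrow> x \<in> input_symbols X \<Longrightarrow>
        s \<in> work_symbols M \<Longrightarrow> trans M q x s = Some (q', s', d, e, v) \<Longrightarrow>
          q' \<in> states M \<and> s' \<in> work_symbols M \<and> v \<in> lists Y \<and> length v \<le> k"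
    using M unfolding transducer_over_def by blast
  obtain l where l: "\<And>q x s q' s' d e v. q \<in> states N \<Longrightarrow> x \<in> input_symbols X \<Longrightarrow>
        s \<in> work_symbols N \<Longrightarrow> trans N q x s = Some (q', s', d, e, v) \<Longrightarrow>
          q' \<in> states N \<and> s' \<in> work_symbols N \<and> v \<in> lists Y \<and> length v \<le> l"
    using N unfolding transducer_over_def by blast
  have start: "start_state M \<in> states M" "start_state N \<in> states N"
    using M N by (auto simp: transducer_over_def)
  have "q' \<in> states ?S \<and> z' \<in> work_symbols ?S \<and> v \<in> lists Y \<and> length v \<le> max k l"
    if asm: "q \<in> states ?S" "x \<in> input_symbols X" "z \<in> work_symbols ?S"
      and step: "trans ?S q x z = Some (q', z', d, e, v)" for q x z q' z' d e v
  proof -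
    obtain m s r where z: "z = (m, s, r)" by (cases z)
    with asm(3) have sr: "s \<in> work_symbols M" "r \<in> work_symbols N"
      by (auto simp: sequential_transducer_def)
    show ?thesis
    proof (cases q)
      case (First p)
      with asm(1) have p: "p \<in> states M" by (auto simp: sequential_transducer_def)
      show ?thesis
      proof (cases "trans M p x s")
        case None
        with First step z sr show ?thesis
          by (auto simp: sequential_transducer_def)
      next
        case (Some t)
        then obtain p' s' d' e' v' where t: "trans M p x s = Some (p', s', d', e', v')"
          by (cases t) auto
        with First step z sr k[OF p asm(2) sr(1) t] show ?thesis
          by (auto simp: sequential_transducer_def)
      qed
    next
      case (Second p)
      with asm(1) have p: "p \<in> states N" by (auto simp: sequential_transducer_def)
      from Second step z obtain p' r' d' e' v' where t: "trans N p x r = Some (p', r', d', e', v')"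
        by (auto simp: sequential_transducer_def)
      with Second step z sr l[OF p asm(2) sr(2) t] show ?thesis
        by (auto simp: sequential_transducer_def)
    qed (use step z sr start in \<open>auto simp: sequential_transducer_def split: if_splits\<close>)
  qed
  moreover have "finite (states ?S)" "start_state ?S \<in> states ?S"
      "finite (work_symbols ?S)" "blank ?S \<in> work_symbols ?S"
    using M N by (auto simp: sequential_transducer_def transducer_over_def)
  ultimately show ?thesis
    unfolding transducer_over_def by blast
qed

text \<open>
  The configurations that mirror those of \<open>M\<close> while it runs. The track of \<open>N\<close> holds its blank \<open>r\<close>
  everywhere.
\<close>

definition first_config ::
    "nat \<Rightarrow> (nat, nat, 'b) config \<Rightarrow> (phase, bool \<times> nat \<times> nat, 'b) config" where
  "first_config r c =
     \<lparr>state = First (state c), input_pos = input_pos c,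
      work_tape = (\<lambda>i. (i = 0, work_tape c i, r)), work_pos = work_pos c, written = written c\<rparr>"

text \<open>
  The configurations that mirror those of \<open>N\<close>, where \<open>t\<close> is what \<open>M\<close> has left on its track and \<open>v\<close>
  is the output of \<open>M\<close>.
\<close>

definition second_config ::
    "(nat \<Rightarrow> nat) \<Rightarrow> 'b list \<Rightarrow> (nat, nat, 'b) config
      \<Rightarrow> (phase, bool \<times> nat \<times> nat, 'b) config" where
  "second_config t v c =
     \<lparr>state = Second (state c), input_pos = input_pos c,
      work_tape = (\<lambda>i. (i = 0, t i, work_tape c i)), work_pos = work_pos c, written = v @ written c\<rparr>"

lemma first_config_run:
  assumes "(step_within M A w)\<^sup>*\<^sup>* c c'" "A \<le> B"
  shows "(step_within (sequential_transducer M N) B w)\<^sup>*\<^sup>* (first_config r c) (first_config r c')"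
proof -
  have "\<exists>d'. (step_within (sequential_transducer M N) B w)\<^sup>*\<^sup>* (first_config r c) d'
      \<and> d' = first_config r c'"
  proof (rule simulation[OF assms(1)])
    fix c c' d assume "step_within M A w c c'" "d = first_config r c"
    then have "step_within (sequential_transducer M N) B w d (first_config r c')"
      using assms(2)
      by (auto simp: step_within_def next_config_def first_config_def sequential_transducer_def
          split: option.splits)
    then show "\<exists>d'. (step_within (sequential_transducer M N) B w)\<^sup>*\<^sup>* d d' \<and> d' = first_config r c'"
      by blast
  qed simp
  then show ?thesis by blast
qed

lemma second_config_run:
  assumes "(step_within N A w)\<^sup>*\<^sup>* c c'" "A \<le> B"
  shows "(step_within (sequential_transducer M N) B w)\<^sup>*\<^sup>* (second_config t v c) (second_config t v c')"
proof -
  have "\<exists>d'. (step_within (sequential_transducer M N) B w)\<^sup>*\<^sup>* (second_config t v c) d'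
      \<and> d' = second_config t v c'"
  proof (rule simulation[OF assms(1)])
    fix c c' d assume "step_within N A w c c'" "d = second_config t v c"
    then have "step_within (sequential_transducer M N) B w d (second_config t v c')"
      using assms(2)
      by (auto simp: step_within_def next_config_def second_config_def sequential_transducer_def
          split: option.splits)
    then show "\<exists>d'. (step_within (sequential_transducer M N) B w)\<^sup>*\<^sup>* d d' \<and> d' = second_config t v c'"
      by blast
  qed simp
  then show ?thesis by blast
qed

text \<open>
  Each step decreases the larger of the two head positions unless both are 0.
\<close>

lemma rewind_run:
  assumes tape: "\<And>i. fst (t i) \<longleftrightarrow> i = 0" and "j < B"
  shows "(step_within (sequential_transducer M N) B w)\<^sup>*\<^sup>*
    \<lparr>state = Rewind, input_pos = p, work_tape = t, work_pos = j, written = v\<rparr>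
    \<lparr>state = Second (start_state N), input_pos = 0, work_tape = t, work_pos = 0, written = v\<rparr>"
  using assms(2)
proof (induction "max p j" arbitrary: p j rule: less_induct)
  case less
  obtain s r where t: "t j = (j = 0, s, r)"
    using tape[of j] by (cases "t j") auto
  show ?case
  proof (cases "p = 0 \<and> j = 0")
    case True
    with t less.prems show ?thesis
      by (intro r_into_rtranclp)
        (auto simp: step_within_def next_config_def sequential_transducer_def scanned_def)
  next
    case False
    let ?p = "min (p - 1) (length w + 1)"
    have "step_within (sequential_transducer M N) B w
      \<lparr>state = Rewind, input_pos = p, work_tape = t, work_pos = j, written = v\<rparr>
      \<lparr>state = Rewind, input_pos = ?p, work_tape = t, work_pos = j - 1, written = v\<rparr>"
      using t False less.prems
      by (auto simp: step_within_def next_config_def sequential_transducer_def scanned_def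
          fun_eq_iff)
    moreover have "max ?p (j - 1) < max p j" "j - 1 < B"
      using False less.prems by auto
    ultimately show ?thesis
      using less.hyps by (meson converse_rtranclp_into_rtranclp)
  qed
qed

lemma outputs_within_sequential:
  assumes M: "outputs_within M A w u" and N: "outputs_within N B w v"
  shows "outputs_within (sequential_transducer M N) (max A B) w (u @ v)"
proof -
  let ?S = "sequential_transducer M N"
  let ?run = "(step_within ?S (max A B) w)\<^sup>*\<^sup>*"
  obtain c where c: "(step_within M A w)\<^sup>*\<^sup>* (initial_config M) c"
      "next_config M w c = None" "written c = u" and A: "0 < A"
    using M by (auto simp: outputs_within_def)
  obtain d where d: "(step_within N B w)\<^sup>*\<^sup>* (initial_config N) d"
      "next_config N w d = None" "written d = v"
    using N by (auto simp: outputs_within_def)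
  have "work_pos c < A"
    using c(1) A by (cases rule: rtranclp.cases) (auto simp: step_within_def initial_config_def)
  then have pos: "work_pos c < max A B" by simp
  let ?t = "\<lambda>i. (i = 0, work_tape c i, blank N)"
  let ?rewind = "\<lparr>state = Rewind, input_pos = min (input_pos c) (length w + 1), work_tape = ?t,
    work_pos = work_pos c, written = u\<rparr>"
  have "?run (initial_config ?S) (first_config (blank N) (initial_config M))"
    using A by (intro r_into_rtranclp)
      (auto simp: step_within_def next_config_def sequential_transducer_def initial_config_def
        first_config_def fun_eq_iff)
  also have "?run \<dots> (first_config (blank N) c)"
    by (rule first_config_run[OF c(1)]) simp
  also have "?run \<dots> ?rewind"
    using c(2,3) pos by (intro r_into_rtranclp)
      (auto simp: step_within_def next_config_def sequential_transducer_def first_config_def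
        fun_eq_iff split: option.splits)
  also have "?run \<dots> (second_config (work_tape c) u (initial_config N))"
    using rewind_run[of ?t "work_pos c" "max A B" M N w _ u] pos
    by (simp add: second_config_def initial_config_def)
  also have "?run \<dots> (second_config (work_tape c) u d)"
    by (rule second_config_run[OF d(1)]) simp
  finally have "?run (initial_config ?S) (second_config (work_tape c) u d)" .
  moreover have "next_config ?S w (second_config (work_tape c) u d) = None"
    using d(2)
    by (auto simp: next_config_def sequential_transducer_def second_config_def split: option.splits)
  moreover have "written (second_config (work_tape c) u d) = u @ v"
    using d(3) by (simp add: second_config_def)
  ultimately show ?thesis
    using A unfolding outputs_within_def by (auto simp: max_def)
qed

lemma logspace_computable_append:
  fixes f g :: "'a list \<Rightarrow> 'b list"
  assumes f: "logspace_computable X Y f" and g: "logspace_computable X Y g"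
  shows "logspace_computable X Y (\<lambda>w. f w @ g w)"
proof -
  let ?log = "\<lambda>w. log 2 (real (max 2 (length w)))"
  obtain M :: "(nat, nat, 'a, 'b) transducer" and a where M: "finite X" "finite Y"
      "transducer_over X Y M" "0 \<le> a"
      "\<And>w. w \<in> lists X \<Longrightarrow> \<exists>A. outputs_within M A w (f w) \<and> real A \<le> a * ?log w"
    by (rule logspace_computableE[OF f]) (rule that; assumption)
  obtain N :: "(nat, nat, 'a, 'b) transducer" and b where N: "transducer_over X Y N" "0 \<le> b"
      "\<And>w. w \<in> lists X \<Longrightarrow> \<exists>B. outputs_within N B w (g w) \<and> real B \<le> b * ?log w"
    by (rule logspace_computableE[OF g]) (rule that; assumption)
  show ?thesis
  proof (rule logspace_computableI[OF M(1,2) transducer_over_sequential[OF M(3) N(1)]])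
    fix w assume "w \<in> lists X"
    then obtain A B where A: "outputs_within M A w (f w)" "real A \<le> a * ?log w"
        and B: "outputs_within N B w (g w)" "real B \<le> b * ?log w"
      using M(5) N(3) by blast
    have "0 \<le> a * ?log w" "0 \<le> b * ?log w"
      using M(4) N(2) by (simp_all add: zero_le_mult_iff)
    with A(2) B(2) have "real (max A B) \<le> (a + b) * ?log w"
      by (simp add: distrib_right)
    with outputs_within_sequential[OF A(1) B(1)]
    show "\<exists>B. outputs_within (sequential_transducer M N) B w (f w @ g w) \<and>
        real B \<le> (a + b) * ?log w"
      by blast
  qed
qed


section \<open>Words over a direct product of groups\<close>

lemma word_value_simps [simp]:
  "word_value G [] = \<one>\<^bsub>G\<^esub>" "word_value G (x # w) = x \<otimes>\<^bsub>G\<^esub> word_value G w"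
  by (simp_all add: word_value_def)

lemma (in group) word_value_closed: "w \<in> lists (carrier G) \<Longrightarrow> word_value G w \<in> carrier G"
  by (induction w) auto

lemma (in group) word_value_in_generate:
  "w \<in> lists S \<Longrightarrow> word_value G w \<in> generate G S"
  by (induction w) (auto intro: generate.intros)

lemma word_value_DirProd:
  "word_value (G \<times>\<times> H) w = (word_value G (map fst w), word_value H (map snd w))"
  by (induction w) (auto simp: DirProd_def)

lemma (in group) word_value_append:
  "u \<in> lists (carrier G) \<Longrightarrow> v \<in> lists (carrier G) \<Longrightarrow>
    word_value G (u @ v) = word_value G u \<otimes> word_value G v"
  by (induction u) (auto simp: word_value_closed m_assoc)

lemma (in group) word_value_ones: "word_value G (map (\<lambda>_. \<one>) w) = \<one>"
  by (induction w) auto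

definition letter_in :: "'a set \<Rightarrow> 'a \<Rightarrow> 'a option" where
  "letter_in X x = (if x \<in> X then Some x else None)"

text \<open>
  Letters whose image under \<open>\<pi>\<close> lies outside \<open>X\<close> contribute \<open>\<one>\<close>, so erasing them does not change the value.
  The map \<open>\<pi>\<close> stands for the projection from the product to a factor. An identity
  element that happens to be a letter of \<open>X\<close> is kept, which is harmless.
\<close>

lemma (in group) word_value_restrict:
  assumes "X \<subseteq> carrier G" "set (map \<pi> w) \<subseteq> insert \<one> X"
  shows "word_value G (List.map_filter (letter_in X \<circ> \<pi>) w) = word_value G (map \<pi> w)"
  using assms(2)
proof (induction w)
  case (Cons z w)
  have "set (map \<pi> (z # w)) \<subseteq> carrier G"
    using subset_trans[OF Cons.prems] assms(1) by auto
  then have "word_value G (map \<pi> w) \<in> carrier G"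
    by (intro word_value_closed) (simp add: lists_eq_set)
  with Cons show ?case
    by (auto simp: letter_in_def map_filter_def)
qed (simp add: map_filter_def)

definition factor_letters ::
    "('a, 'c) monoid_scheme \<Rightarrow> ('b, 'd) monoid_scheme \<Rightarrow> 'a set \<Rightarrow> 'b set \<Rightarrow> ('a \<times> 'b) set" where
  "factor_letters G H X Y = (\<lambda>x. (x, \<one>\<^bsub>H\<^esub>)) ` X \<union> Pair \<one>\<^bsub>G\<^esub> ` Y"

definition product_word ::
    "('a, 'c) monoid_scheme \<Rightarrow> ('b, 'd) monoid_scheme \<Rightarrow> 'a list \<Rightarrow> 'b list \<Rightarrow> ('a \<times> 'b) list" where
  "product_word G H u v = map (\<lambda>x. (x, \<one>\<^bsub>H\<^esub>)) u @ map (Pair \<one>\<^bsub>G\<^esub>) v"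

lemma product_word_in_lists:
  "u \<in> lists X \<Longrightarrow> v \<in> lists Y \<Longrightarrow> product_word G H u v \<in> lists (factor_letters G H X Y)"
  by (auto simp: product_word_def factor_letters_def)

lemma word_value_product_word:
  assumes "group G" "group H" "u \<in> lists (carrier G)" "v \<in> lists (carrier H)"
  shows "word_value (G \<times>\<times> H) (product_word G H u v) = (word_value G u, word_value H v)"
proof -
  interpret G: group G by fact
  interpret H: group H by fact
  have "word_value G (u @ map (\<lambda>_. \<one>\<^bsub>G\<^esub>) v) = word_value G u"
    using assms(3) by (subst G.word_value_append) (auto simp: G.word_value_ones G.word_value_closed simp del: map_replicate_const)
  moreover have "word_value H (map (\<lambda>_. \<one>\<^bsub>H\<^esub>) u @ v) = word_value H v"
    using assms(4) by (subst H.word_value_append) (auto simp: H.word_value_ones H.word_value_closed simp del: map_replicate_const)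
  ultimately show ?thesis
    by (simp add: product_word_def word_value_DirProd comp_def)
qed

text \<open>
  The value of a concatenation is the pair of the two values, so it determines both parts.
  This also holds when the letter \<open>(\<one>, \<one>)\<close> comes from \<open>X\<close> as well as from \<open>Y\<close> and a
  word alone does not show where its first part ends.
\<close>

lemma normal_form_product:
  assumes G: "group G" "X \<subseteq> carrier G" "normal_form G X K"
    and H: "group H" "Y \<subseteq> carrier H" "normal_form H Y L"
  shows "normal_form (G \<times>\<times> H) (factor_letters G H X Y) (case_prod (product_word G H) ` (K \<times> L))"
proof -
  let ?p = "case_prod (product_word G H)"
  have K: "K \<subseteq> lists X" "bij_betw (word_value G) K (carrier G)"
    and L: "L \<subseteq> lists Y" "bij_betw (word_value H) L (carrier H)"
    using G H by (auto simp: normal_form_def)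
  have "bij_betw (map_prod (word_value G) (word_value H)) (K \<times> L) (carrier (G \<times>\<times> H))"
    using K(2) L(2) by (auto intro: bij_betw_map_prod simp: DirProd_def)
  moreover have eq: "(word_value (G \<times>\<times> H) \<circ> ?p) z = map_prod (word_value G) (word_value H) z"
    if z: "z \<in> K \<times> L" for z
  proof -
    obtain u v where "z = (u, v)" "u \<in> K" "v \<in> L"
      using z by blast
    moreover have "K \<subseteq> lists (carrier G)" "L \<subseteq> lists (carrier H)"
      using K(1) L(1) lists_mono[OF G(2)] lists_mono[OF H(2)] by blast+
    ultimately show ?thesis
      using word_value_product_word[OF G(1) H(1), of u v] by auto
  qed
  ultimately have "bij_betw (word_value (G \<times>\<times> H) \<circ> ?p) (K \<times> L) (carrier (G \<times>\<times> H))"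
    by (subst bij_betw_cong[OF eq])
  then have "bij_betw (word_value (G \<times>\<times> H)) (?p ` (K \<times> L)) (carrier (G \<times>\<times> H))"
    unfolding bij_betw_def by (metis image_comp inj_on_imageI)
  moreover have "?p ` (K \<times> L) \<subseteq> lists (factor_letters G H X Y)"
  proof (intro image_subsetI)
    fix z assume "z \<in> K \<times> L"
    then obtain u v where "z = (u, v)" "u \<in> lists X" "v \<in> lists Y"
      using K(1) L(1) by blast
    then show "?p z \<in> lists (factor_letters G H X Y)"
      using product_word_in_lists[of u X v Y] by simp
  qed
  ultimately show ?thesis
    unfolding normal_form_def by (rule conjI[rotated])
qed

text \<open>
  The normal form already represents every element of the product by a word over these
  letters, which shows that they generate it.
\<close>

lemma symmetric_generating_set_product:
  assumes G: "group G" "symmetric_generating_set G X" "normal_form G X K"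
    and H: "group H" "symmetric_generating_set H Y" "normal_form H Y L"
  shows "symmetric_generating_set (G \<times>\<times> H) (factor_letters G H X Y)"
proof -
  interpret G: group G by fact
  interpret H: group H by fact
  interpret P: group "G \<times>\<times> H" by (rule DirProd_group) fact+
  let ?Z = "factor_letters G H X Y"
  have X: "X \<subseteq> carrier G" "\<forall>x\<in>X. inv\<^bsub>G\<^esub> x \<in> X" and Y: "Y \<subseteq> carrier H" "\<forall>y\<in>Y. inv\<^bsub>H\<^esub> y \<in> Y"
    using G H by (auto simp: symmetric_generating_set_def)
  have Z: "?Z \<subseteq> carrier (G \<times>\<times> H)"
    using X Y by (auto simp: factor_letters_def)
  have "inv\<^bsub>G \<times>\<times> H\<^esub> z \<in> ?Z" if "z \<in> ?Z" for z
    using that X Y inv_DirProd[OF G(1) H(1)] unfolding factor_letters_def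
    by (elim UnE imageE) (auto simp: subset_iff)
  moreover have "carrier (G \<times>\<times> H) \<subseteq> generate (G \<times>\<times> H) ?Z"
  proof -
    have "word_value (G \<times>\<times> H) ` lists ?Z \<subseteq> generate (G \<times>\<times> H) ?Z"
      by (intro image_subsetI P.word_value_in_generate)
    moreover have "carrier (G \<times>\<times> H) \<subseteq> word_value (G \<times>\<times> H) ` lists ?Z"
      using normal_form_product[OF G(1) X(1) G(3) H(1) Y(1) H(3)]
      unfolding normal_form_def by (metis bij_betw_imp_surj_on image_mono)
    ultimately show ?thesis
      by (rule order_trans[rotated])
  qed
  ultimately show ?thesis
    using Z P.generate_incl[OF Z] unfolding symmetric_generating_set_def
    by (intro conjI ballI equalityI)
qed


section \<open>Direct products\<close>

lemma has_logspace_normal_formE: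
  assumes "has_logspace_normal_form G"
  obtains X f L where "finite X" "symmetric_generating_set G X" "logspace_computable X X f"
    "normal_form G X L" "\<And>w. w \<in> lists X \<Longrightarrow> f w \<in> L \<and> word_value G (f w) = word_value G w"
proof -
  obtain X f where X: "finite X" "symmetric_generating_set G X"
      and f: "logspace_normal_form_function G X f"
    using assms unfolding has_logspace_normal_form_def has_logspace_normal_form_over_def by metis
  obtain L where "normal_form G X L" "\<forall>w\<in>lists X. f w \<in> L \<and> word_value G (f w) = word_value G w"
    using f unfolding logspace_normal_form_function_def by metis
  moreover have "logspace_computable X X f"
    using f by (simp add: logspace_normal_form_function_def)
  ultimately show thesis
    using X that by metis
qed

theorem proposition13:
  fixes G :: "('a, 'c) monoid_scheme" and H :: "('b, 'd) monoid_scheme"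
  assumes "group G" and "group H"
    and "finitely_generated G" and "finitely_generated H"
    and "has_logspace_normal_form G" and "has_logspace_normal_form H"
  shows "has_logspace_normal_form (G \<times>\<times> H)"
proof -
  interpret G: group G by fact
  interpret H: group H by fact
  obtain X f K where X: "finite X" "symmetric_generating_set G X"
      and f: "logspace_computable X X f" and K: "normal_form G X K"
      and fK: "\<And>w. w \<in> lists X \<Longrightarrow> f w \<in> K \<and> word_value G (f w) = word_value G w"
    using has_logspace_normal_formE[OF assms(5)] by metis
  obtain Y g L where Y: "finite Y" "symmetric_generating_set H Y"
      and g: "logspace_computable Y Y g" and L: "normal_form H Y L"
      and gL: "\<And>w. w \<in> lists Y \<Longrightarrow> g w \<in> L \<and> word_value H (g w) = word_value H w"
    using has_logspace_normal_formE[OF assms(6)] by metis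
  have XG: "X \<subseteq> carrier G" and YH: "Y \<subseteq> carrier H"
    using X(2) Y(2) by (auto simp: symmetric_generating_set_def)
  let ?Z = "factor_letters G H X Y"
  let ?u = "List.map_filter (letter_in X \<circ> fst)" and ?v = "List.map_filter (letter_in Y \<circ> snd)"
  let ?h = "\<lambda>w. product_word G H (f (?u w)) (g (?v w))"
  have Z: "finite ?Z" using X(1) Y(1) by (simp add: factor_letters_def)
  have "logspace_computable ?Z ?Z ?h"
    unfolding product_word_def
    by (intro logspace_computable_append logspace_computable_erasing[OF f Z Z]
        logspace_computable_erasing[OF g Z Z])
      (auto simp: letter_in_def factor_letters_def split: if_splits)
  moreover have "?h w \<in> case_prod (product_word G H) ` (K \<times> L) \<and>
      word_value (G \<times>\<times> H) (?h w) = word_value (G \<times>\<times> H) w" if w: "w \<in> lists ?Z" for w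
  proof -
    have u: "?u w \<in> lists X" and v: "?v w \<in> lists Y"
      by (auto simp: map_filter_def letter_in_def split: if_splits)
    have "f (?u w) \<in> lists (carrier G)" "g (?v w) \<in> lists (carrier H)"
      using fK[OF u] gL[OF v] K L lists_mono[OF XG] lists_mono[OF YH]
      unfolding normal_form_def by blast+
    then have "word_value (G \<times>\<times> H) (?h w) = (word_value G (?u w), word_value H (?v w))"
      using fK[OF u] gL[OF v] by (subst word_value_product_word[OF assms(1,2)]) auto
    also have "\<dots> = word_value (G \<times>\<times> H) w"
    proof -
      have "set (map fst w) \<subseteq> insert \<one>\<^bsub>G\<^esub> X" "set (map snd w) \<subseteq> insert \<one>\<^bsub>H\<^esub> Y"
        using w by (auto simp: factor_letters_def)
      then show ?thesis
        by (simp only: word_value_DirProd G.word_value_restrict[OF XG] H.word_value_restrict[OF YH])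
    qed
    finally show ?thesis
      using fK[OF u] gL[OF v] by blast
  qed
  ultimately have "logspace_normal_form_function (G \<times>\<times> H) ?Z ?h"
    using normal_form_product[OF assms(1) XG K assms(2) YH L]
    unfolding logspace_normal_form_function_def by (intro conjI exI) (assumption | blast)+
  then show ?thesis
    using Z symmetric_generating_set_product[OF assms(1) X(2) K assms(2) Y(2) L]
    unfolding has_logspace_normal_form_def has_logspace_normal_form_over_def
    by (intro exI conjI)
qed

end
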